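(* Let $p,q\in\mathbb R$, and let the real variables $x$ and $y$ occur in the range $x\in\mathbb R$ and $|y|<x$. For $z=(x,y)^T$ consider the vector equation $$z\ast_h z+p\,z+q\,\mathbf 1=\mathfrak o .$$ If $q-\frac{p^2}{4}>0$, then this equation has no solution. If $\frac{p^2}{4}-q\ge0$, then, with $x_{1/2}=-\frac p2\pm\sqrt{\frac{p^2}{4}-q}$, this equation has the solutions $$z_{1/2}=(x_{1/2},\,0)^T=x_{1/2}\,\mathbf 1\quad\text{and}\quad z_{3/4}=-\frac p2\,\mathbf 1\pm\sqrt{\frac{p^2}{4}-q}\;\mathbf I .$$
   Context: Vectors in $\mathbb R^2$ are columns; addition and multiplication by real scalars are the usual componentwise operations. Notation: $\mathbf 1=(1,0)^T$, $\mathbf I=(0,1)^T$, $\mathfrak o=(0,0)^T$. The hyperbolic vector-valued product, denoted $\ast_h$, is $$(x_1,\,y_1)^T\ast_h(x_2,\,y_2)^T=(x_1x_2+y_1y_2,\; x_1y_2+x_2y_1)^T,$$ so that $z\ast_h z=(x^2+y^2,\,2xy)^T$ for $z=(x,y)^T$.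
   Formalization: The four vectors need not satisfy |y|<x (for p=q=0 all are zero), so they are shown to solve the equation as vectors of the plane, and the solutions with |y|<x are shown to be exactly those of the four lying in that range. *)

theory Defs
  imports "HOL-Analysis.Analysis"
begin

text \<open>Columns of the plane are elements of \<open>real ^ 2\<close>; addition, scalar multiplication and
  the zero vector are the library ones.\<close>

definition hprod :: "real ^ 2 \<Rightarrow> real ^ 2 \<Rightarrow> real ^ 2" (infixl "*\<^sub>h" 70) where
  "z *\<^sub>h w = vector [z $ 1 * w $ 1 + z $ 2 * w $ 2, z $ 1 * w $ 2 + w $ 1 * z $ 2]"

definition hone :: "real ^ 2" where
  "hone = vector [1, 0]"

definition himag :: "real ^ 2" where
  "himag = vector [0, 1]"

definition hrange :: "(real ^ 2) set" where
  "hrange = {z. \<bar>z $ 2\<bar> < z $ 1}"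

definition solves_hquadratic :: "real \<Rightarrow> real \<Rightarrow> real ^ 2 \<Rightarrow> bool" where
  "solves_hquadratic p q z \<longleftrightarrow> z *\<^sub>h z + p *\<^sub>R z + q *\<^sub>R hone = 0"

end

theory Submission
  imports Defs
begin

text \<open>Completing the square with w = z + (p/2) \<open>hone\<close> turns the equation into w
  *h w = d \<open>hone\<close>, where d = p^2/4 - q. In coordinates this reads w1^2 + w2^2 = d and 2
  w1 w2 = 0, so one coordinate of w vanishes and the square of the other is d. This is impossible
  for d < 0. For d \<ge> 0 it leaves two roots on each axis; the pair along \<open>himag\<close>
  exists because \<open>himag\<close> squares to \<open>hone\<close>.\<close>

lemma solves_hquadratic_iff:
  "solves_hquadratic p q z \<longleftrightarrow>
    z $ 2 = 0 \<and> (z $ 1 + p / 2)\<^sup>2 = p\<^sup>2 / 4 - q \<or>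
    z $ 1 = - p / 2 \<and> (z $ 2)\<^sup>2 = p\<^sup>2 / 4 - q"
proof -
  let ?x = "z $ 1" and ?y = "z $ 2"
  have "solves_hquadratic p q z \<longleftrightarrow> ?x\<^sup>2 + ?y\<^sup>2 + p * ?x + q = 0 \<and> ?y * (2 * ?x + p) = 0"
    by (simp add: solves_hquadratic_def hprod_def hone_def vec_eq_iff forall_2 power2_eq_square
        algebra_simps)
  \<comment> \<open>With the square completed, either factor of the second equation that vanishes
    also removes one square from the first.\<close>
  also have "?x\<^sup>2 + ?y\<^sup>2 + p * ?x + q = (?x + p / 2)\<^sup>2 + ?y\<^sup>2 - (p\<^sup>2 / 4 - q)"
    by (simp add: power2_eq_square field_simps)
  also have "?y * (2 * ?x + p) = 0 \<longleftrightarrow> ?y = 0 \<or> ?x = - p / 2"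
    by auto
  finally show ?thesis
    by auto
qed

lemma square_eq_iff_sqrt:
  fixes a d :: real
  assumes "0 \<le> d"
  shows "a\<^sup>2 = d \<longleftrightarrow> a = sqrt d \<or> a = - sqrt d"
  using assms by (metis power2_eq_iff real_sqrt_pow2)

text \<open>Describing the solutions in the whole plane serves both claims for d \<ge> 0: all four
  points solve the equation, and the solutions in \<open>hrange\<close> are those of the four that
  lie there.\<close>

lemma solves_hquadratic_iff_roots:
  assumes "0 \<le> p\<^sup>2 / 4 - q"
  defines "s \<equiv> sqrt (p\<^sup>2 / 4 - q)"
  shows "solves_hquadratic p q z \<longleftrightarrow>
    z \<in> {vector [- p / 2 + s, 0], vector [- p / 2 - s, 0],
      (- p / 2) *\<^sub>R hone + s *\<^sub>R himag, (- p / 2) *\<^sub>R hone - s *\<^sub>R himag}"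
  unfolding solves_hquadratic_iff square_eq_iff_sqrt[OF assms(1)] s_def[symmetric]
  by (auto simp: vec_eq_iff forall_2 hone_def himag_def)

theorem theorem5p1:
  fixes p q :: real
  shows "(q - p\<^sup>2 / 4 > 0 \<longrightarrow> \<not> (\<exists>z \<in> hrange. solves_hquadratic p q z)) \<and>
    (p\<^sup>2 / 4 - q \<ge> 0 \<longrightarrow>
      (let x\<^sub>1 = - p / 2 + sqrt (p\<^sup>2 / 4 - q);
           x\<^sub>2 = - p / 2 - sqrt (p\<^sup>2 / 4 - q);
           z\<^sub>1 = vector [x\<^sub>1, 0] :: real ^ 2;
           z\<^sub>2 = vector [x\<^sub>2, 0] :: real ^ 2;
           z\<^sub>3 = (- p / 2) *\<^sub>R hone + sqrt (p\<^sup>2 / 4 - q) *\<^sub>R himag;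
           z\<^sub>4 = (- p / 2) *\<^sub>R hone - sqrt (p\<^sup>2 / 4 - q) *\<^sub>R himag
       in z\<^sub>1 = x\<^sub>1 *\<^sub>R hone \<and> z\<^sub>2 = x\<^sub>2 *\<^sub>R hone \<and>
          (\<forall>z \<in> {z\<^sub>1, z\<^sub>2, z\<^sub>3, z\<^sub>4}. solves_hquadratic p q z) \<and>
          {z \<in> hrange. solves_hquadratic p q z} = {z\<^sub>1, z\<^sub>2, z\<^sub>3, z\<^sub>4} \<inter> hrange))"
proof (intro conjI impI)
  assume "q - p\<^sup>2 / 4 > 0"
  \<comment> \<open>Each alternative in \<open>solves_hquadratic_iff\<close> requires a real square
    equal to this negative number.\<close>
  then have "a\<^sup>2 \<noteq> p\<^sup>2 / 4 - q" for a
    using zero_le_power2[of a] by linarith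
  then show "\<not> (\<exists>z \<in> hrange. solves_hquadratic p q z)"
    by (simp add: solves_hquadratic_iff)
next
  assume "p\<^sup>2 / 4 - q \<ge> 0"
  note roots = solves_hquadratic_iff_roots[OF this]
  have real_axis: "vector [x, 0] = x *\<^sub>R hone" for x
    by (simp add: vec_eq_iff forall_2 hone_def)
  show "let x\<^sub>1 = - p / 2 + sqrt (p\<^sup>2 / 4 - q);
           x\<^sub>2 = - p / 2 - sqrt (p\<^sup>2 / 4 - q);
           z\<^sub>1 = vector [x\<^sub>1, 0] :: real ^ 2;
           z\<^sub>2 = vector [x\<^sub>2, 0] :: real ^ 2;
           z\<^sub>3 = (- p / 2) *\<^sub>R hone + sqrt (p\<^sup>2 / 4 - q) *\<^sub>R himag;
           z\<^sub>4 = (- p / 2) *\<^sub>R hone - sqrt (p\<^sup>2 / 4 - q) *\<^sub>R himag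
       in z\<^sub>1 = x\<^sub>1 *\<^sub>R hone \<and> z\<^sub>2 = x\<^sub>2 *\<^sub>R hone \<and>
          (\<forall>z \<in> {z\<^sub>1, z\<^sub>2, z\<^sub>3, z\<^sub>4}. solves_hquadratic p q z) \<and>
          {z \<in> hrange. solves_hquadratic p q z} = {z\<^sub>1, z\<^sub>2, z\<^sub>3, z\<^sub>4} \<inter> hrange"
    \<comment> \<open>After rewriting with \<open>roots\<close>, only membership in the explicit
      four-point set remains to be compared.\<close>
    unfolding Let_def roots by (intro conjI real_axis) auto
qed

end
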